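(* Let $l\ge2$ be an integer and let $(\alpha,\beta)=(0,0)$ or $(\alpha,\beta)=(1,w^2)$. Let $$H=\left(\begin{array}{c|c}\tilde H&\mathbf 0_{4\times 5(l-2)}\\ \hline \mathbf 0_{2(l-2)\times 9}& I_{l-2}\otimes\begin{pmatrix}1&0&1&1&1\\0&1&1&w&w^2\end{pmatrix}\end{array}\right),\qquad \tilde H=\begin{pmatrix}1&0&1&1&\alpha&0&0&0&0\\0&1&1&w&\beta&0&0&0&0\\0&0&0&0&1&0&1&1&1\\0&0&0&0&0&1&1&w&w^2\end{pmatrix}$$ over $\mathbb F_4$. Then the linear code with parity-check matrix $H$ is an optimal quaternary $[n,k,d]$ $(r,\delta)$-LRC code with $n=5l-1$, $k=3l-1$, $d=3$, $r=3$, $\delta=3$.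
   Context: $\mathbb F_4=\{0,1,w,w^2\}$ with $w^2=w+1$, $w^3=1$; $I_m$ is the $m\times m$ identity matrix and $\otimes$ the Kronecker product (for $l=2$ the blocks involving $l-2$ are empty). For a linear code $\mathcal C\subseteq\mathbb{F}_q^n$ and $R\subseteq[n]=\{1,\dots,n\}$, $\mathcal C|_R$ is the code obtained by puncturing (deleting) the coordinates outside $R$. An $[n,k,d]$ linear code $\mathcal C$ is an $(r,\delta)$-LRC code if for every $i\in[n]$ there is $R_i\subseteq[n]$ with $i\in R_i$, $|R_i|\le r+\delta-1$, such that $\mathcal C|_{R_i}$ has minimum distance at least $\delta$ (every nonzero word has weight at least $\delta$). Every such code satisfies $d\le n-k+1-(\lceil k/r\rceil-1)(\delta-1)$; it is $d$-optimal if equality holds. An $(r,\delta)$-LRC code is $r$-optimal if it is not an $(r',\delta)$-LRC code for any $1\le r'<r$. "Optimal $(r,\delta)$-LRC code" means an $(r,\delta)$-LRC code that is both $d$-optimal and $r$-optimal, with $d\ge\delta>2$ and $k>r\ge1$. *)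

theory Defs
  imports
    "HOL-Library.Cardinality"
    "Jordan_Normal_Form.Matrix"
    "Jordan_Normal_Form.Matrix_Kernel"
begin

text \<open>
  A code of length \<open>n\<close> over a field \<open>'a\<close> is a set of vectors of dimension \<open>n\<close>. Coordinates are
  indexed by \<open>{..<n}\<close> instead of \<open>{1..n}\<close>.
\<close>

definition linear_code :: "nat \<Rightarrow> 'a::field vec set \<Rightarrow> bool" where
  "linear_code n C \<longleftrightarrow> VectorSpace.subspace class_ring C (module_vec TYPE('a) n)"

definition code_dim :: "nat \<Rightarrow> 'a::field vec set \<Rightarrow> nat" where
  "code_dim n C = vectorspace.dim class_ring ((module_vec TYPE('a) n)\<lparr>carrier := C\<rparr>)"

definition hamming_dist :: "'a vec \<Rightarrow> 'a vec \<Rightarrow> nat" where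
  "hamming_dist x y = card {i. i < dim_vec x \<and> x $ i \<noteq> y $ i}"

definition hamming_weight :: "'a::zero vec \<Rightarrow> nat" where
  "hamming_weight x = card {i. i < dim_vec x \<and> x $ i \<noteq> 0}"

text \<open>On a code with at most one word the value is \<open>Inf {} = 0\<close>.\<close>

definition min_dist :: "'a vec set \<Rightarrow> nat" where
  "min_dist C = Inf {hamming_dist x y | x y. x \<in> C \<and> y \<in> C \<and> x \<noteq> y}"

definition nkd_code :: "nat \<Rightarrow> nat \<Rightarrow> nat \<Rightarrow> 'a::field vec set \<Rightarrow> bool" where
  "nkd_code n k d C \<longleftrightarrow> linear_code n C \<and> code_dim n C = k \<and> min_dist C = d"

definition parity_check_code :: "'a::field mat \<Rightarrow> 'a vec set" where
  "parity_check_code H = mat_kernel H"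

definition puncture :: "nat set \<Rightarrow> 'a vec set \<Rightarrow> 'a vec set" where
  "puncture R C = (\<lambda>c. vec_of_list (nths (list_of_vec c) R)) ` C"

text \<open>Unlike a bound on \<^const>\<open>min_dist\<close>, this holds for the zero code.\<close>

definition min_dist_at_least :: "nat \<Rightarrow> 'a::field vec set \<Rightarrow> bool" where
  "min_dist_at_least \<delta> C \<longleftrightarrow> (\<forall>c\<in>C. c \<noteq> 0\<^sub>v (dim_vec c) \<longrightarrow> \<delta> \<le> hamming_weight c)"

definition lrc_code :: "nat \<Rightarrow> nat \<Rightarrow> nat \<Rightarrow> 'a::field vec set \<Rightarrow> bool" where
  "lrc_code n r \<delta> C \<longleftrightarrow> linear_code n C \<and>
     (\<forall>i<n. \<exists>R\<subseteq>{..<n}. i \<in> R \<and> card R \<le> r + \<delta> - 1 \<and> min_dist_at_least \<delta> (puncture R C))"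

definition d_optimal :: "nat \<Rightarrow> nat \<Rightarrow> nat \<Rightarrow> nat \<Rightarrow> nat \<Rightarrow> bool" where
  "d_optimal n k d r \<delta> \<longleftrightarrow>
     int d = int n - int k + 1 - (\<lceil>real k / real r\<rceil> - 1) * (int \<delta> - 1)"

definition r_optimal :: "nat \<Rightarrow> nat \<Rightarrow> nat \<Rightarrow> 'a::field vec set \<Rightarrow> bool" where
  "r_optimal n r \<delta> C \<longleftrightarrow> (\<forall>r'. 1 \<le> r' \<and> r' < r \<longrightarrow> \<not> lrc_code n r' \<delta> C)"

definition optimal_lrc_code ::
    "nat \<Rightarrow> nat \<Rightarrow> nat \<Rightarrow> nat \<Rightarrow> nat \<Rightarrow> 'a::field vec set \<Rightarrow> bool" where
  "optimal_lrc_code n k d r \<delta> C \<longleftrightarrow>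
     nkd_code n k d C \<and> lrc_code n r \<delta> C \<and> d_optimal n k d r \<delta> \<and> r_optimal n r \<delta> C \<and>
     d \<ge> \<delta> \<and> \<delta> > 2 \<and> k > r \<and> r \<ge> 1"

definition kronecker :: "'a::times mat \<Rightarrow> 'a mat \<Rightarrow> 'a mat" where
  "kronecker A B = mat (dim_row A * dim_row B) (dim_col A * dim_col B)
     (\<lambda>(i, j). A $$ (i div dim_row B, j div dim_col B) * B $$ (i mod dim_row B, j mod dim_col B))"

definition H_block :: "'a::field \<Rightarrow> 'a mat" where
  "H_block w = mat_of_rows_list 5
     [[1, 0, 1, 1, 1],
      [0, 1, 1, w, w^2]]"

definition H_tilde :: "'a::field \<Rightarrow> 'a \<Rightarrow> 'a \<Rightarrow> 'a mat" where
  "H_tilde w \<alpha> \<beta> = mat_of_rows_list 9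
     [[1, 0, 1, 1, \<alpha>, 0, 0, 0, 0],
      [0, 1, 1, w, \<beta>, 0, 0, 0, 0],
      [0, 0, 0, 0, 1, 0, 1, 1, 1],
      [0, 0, 0, 0, 0, 1, 1, w, w^2]]"

definition H_mat :: "'a::field \<Rightarrow> 'a \<Rightarrow> 'a \<Rightarrow> nat \<Rightarrow> 'a mat" where
  "H_mat w \<alpha> \<beta> l = four_block_mat
     (H_tilde w \<alpha> \<beta>)          (0\<^sub>m 4 (5 * (l - 2)))
     (0\<^sub>m (2 * (l - 2)) 9)     (kronecker (1\<^sub>m (l - 2)) (H_block w))"

end

theory Submission
  imports Defs
begin

text \<open>
  In each of the groups \<open>{0..4}\<close> (or \<open>{0..3}\<close> when \<open>\<alpha> = \<beta> = 0\<close>), \<open>{4..8}\<close>, \<open>{9..13}\<close>, ... the word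
  satisfies two parity checks whose columns are pairwise independent, so it has weight 0 or at least 3
  there. This gives the locality and, since the groups cover all coordinates, also \<open>d \<ge> 3\<close>. The
  dimension follows from rank-nullity, as \<open>H\<close> has full row rank.

  For \<open>r\<close>-optimality, a repair set of size at most 4 for coordinate 5 must contain the supports
  \<open>{5, 6, 7}\<close> and \<open>{5, 6, 8}\<close> of two codewords, since it meets both. Hence it is \<open>{5..8}\<close>, but some
  codeword meets that set in exactly two coordinates. No Singleton-type bound is needed.
\<close>

text \<open>Keeps indices in the form \<open>m + 2\<close> or \<open>a + 2\<close> used throughout,
  instead of nested successors.\<close>

declare add_2_eq_Suc' [simp del]

section \<open>Parity-check codes as kernels of linear maps\<close>

lemma linear_map_mult_mat_vec:
  fixes A :: "'a::field mat"
  assumes A: "A \<in> carrier_mat nr nc"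
  shows "linear_map class_ring (module_vec TYPE('a) nc) (module_vec TYPE('a) nr) (\<lambda>v. A *\<^sub>v v)"
proof -
  interpret V: vec_space "TYPE('a)" nc .
  interpret W: vec_space "TYPE('a)" nr .
  show ?thesis
    by unfold_locales
      (use A mult_add_distrib_mat_vec[OF A] mult_mat_vec[OF A] in
        \<open>auto simp: LinearCombinations.module_hom_def module_vec_simps\<close>)
qed

lemma linear_parity_check_code:
  fixes A :: "'a::field mat"
  assumes A: "A \<in> carrier_mat nr nc"
  shows "linear_code nc (parity_check_code A)"
proof -
  interpret T: linear_map class_ring "module_vec TYPE('a) nc" "module_vec TYPE('a) nr" "\<lambda>v. A *\<^sub>v v"
    by (rule linear_map_mult_mat_vec[OF A])
  have "T.kerT = parity_check_code A"
    using A by (auto simp: T.ker_def parity_check_code_def mat_kernel module_vec_simps)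
  with T.kerT_is_subspace show ?thesis by (simp add: linear_code_def)
qed

text \<open>Full row rank enters as surjectivity, so the image in rank-nullity is the whole target
  space.\<close>

lemma code_dim_parity_check_code:
  fixes A :: "'a::field mat"
  assumes A: "A \<in> carrier_mat nr nc"
    and surj: "\<And>y. y \<in> carrier_vec nr \<Longrightarrow> \<exists>x\<in>carrier_vec nc. A *\<^sub>v x = y"
  shows "code_dim nc (parity_check_code A) = nc - nr"
proof -
  interpret T: linear_map class_ring "module_vec TYPE('a) nc" "module_vec TYPE('a) nr" "\<lambda>v. A *\<^sub>v v"
    by (rule linear_map_mult_mat_vec[OF A])
  interpret V: vec_space "TYPE('a)" nc .
  interpret W: vec_space "TYPE('a)" nr .
  have ker: "T.kerT = parity_check_code A"
    using A by (auto simp: T.ker_def parity_check_code_def mat_kernel module_vec_simps)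
  have im: "T.imT = carrier_vec nr"
    using A surj by (auto simp: T.im_def module_vec_simps image_iff)
  \<comment> \<open>Rank-nullity speaks of the target space with its carrier replaced by the image;
    here that replacement changes nothing.\<close>
  have vs: "module_vec TYPE('a) nr\<lparr>carrier := carrier_vec nr\<rparr> = module_vec TYPE('a) nr"
    by (simp add: module_vec_def)
  have "nr + code_dim nc (parity_check_code A) = nc"
    using T.rank_nullity_main(1)[OF V.fin_dim]
    unfolding ker im vs W.dim_is_n V.dim_is_n code_dim_def .
  then show ?thesis by simp
qed

section \<open>Weights of punctured words\<close>

lemma hamming_weight_puncture:
  fixes c :: "'a::field vec"
  assumes "c \<in> carrier_vec n" "R \<subseteq> {..<n}"
  shows "hamming_weight (vec_of_list (nths (list_of_vec c) R)) = card {i \<in> R. c $ i \<noteq> 0}"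
proof -
  let ?xs = "nths (list_of_vec c) R"
  have nth: "list_of_vec c ! i = c $ i" for i
    by (metis vec_list vec_of_list_index)
  have "hamming_weight (vec_of_list ?xs) = card {i. i < length ?xs \<and> ?xs ! i \<noteq> 0}"
    by (simp add: hamming_weight_def vec_of_list_index)
  also have "\<dots> = length (filter (\<lambda>a. a \<noteq> 0) ?xs)"
    by (simp add: length_filter_conv_card)
  \<comment> \<open>Puncturing renumbers coordinates. Pairing each entry with its old index merges
    the selection by \<open>R\<close> and the test for nonzero entries into one filter over the old
    indices.\<close>
  also have "\<dots> = length (filter (\<lambda>p. snd p \<in> R \<and> fst p \<noteq> 0) (zip (list_of_vec c) [0..<n]))"
    using assms by (simp add: nths_def filter_map o_def conj_commute)
  also have "\<dots> = card {i. i < n \<and> i \<in> R \<and> list_of_vec c ! i \<noteq> 0}"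
    using assms by (subst length_filter_conv_card) (auto intro!: arg_cong[of _ _ card])
  also have "{i. i < n \<and> i \<in> R \<and> list_of_vec c ! i \<noteq> 0} = {i \<in> R. c $ i \<noteq> 0}"
    using assms by (auto simp: nth)
  finally show ?thesis .
qed

lemma hamming_weight_eq_0_iff:
  fixes c :: "'a::field vec"
  shows "hamming_weight c = 0 \<longleftrightarrow> c = 0\<^sub>v (dim_vec c)"
  by (auto simp: hamming_weight_def vec_eq_iff)

text \<open>Moves the distance condition back to the original coordinates: a punctured word is zero
  exactly when its count on \<open>R\<close> is 0.\<close>

lemma min_dist_at_least_puncture:
  fixes C :: "'a::field vec set"
  assumes "C \<subseteq> carrier_vec n" "R \<subseteq> {..<n}"
  shows "min_dist_at_least \<delta> (puncture R C) \<longleftrightarrow>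
    (\<forall>c\<in>C. card {i \<in> R. c $ i \<noteq> 0} = 0 \<or> \<delta> \<le> card {i \<in> R. c $ i \<noteq> 0})"
proof -
  have "hamming_weight (vec_of_list (nths (list_of_vec c) R)) = card {i \<in> R. c $ i \<noteq> 0}"
    if "c \<in> C" for c
    using hamming_weight_puncture[of c n R] assms that by auto
  then show ?thesis
    unfolding min_dist_at_least_def puncture_def
    by (auto simp flip: hamming_weight_eq_0_iff)
qed

section \<open>Characteristic two\<close>

lemma two_eq_0:
  assumes "CARD('a::{field,finite}) = 4"
  shows "(1::'a) + 1 = 0"
proof -
  \<comment> \<open>Translation by 1 permutes the field, so the added ones, as many as the field has
    elements, sum to zero.\<close>
  have "(\<Sum>x\<in>(UNIV::'a set). x + 1) = (\<Sum>x\<in>UNIV. x)"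
    by (rule sum.reindex_bij_witness[of _ "\<lambda>x. x - 1" "\<lambda>x. x + 1"]) auto
  then have "of_nat (CARD('a)) = (0::'a)" by (simp add: sum.distrib)
  \<comment> \<open>Four is two times two, and a field has no zero divisors.\<close>
  then have "(1 + 1) * (1 + 1) = (0::'a)" using assms by simp
  then show ?thesis by (metis mult_eq_0_iff)
qed

section \<open>The parity-check matrix in coordinates\<close>

lemma dim_H_tilde_H_block [simp]:
  "dim_row (H_tilde w \<alpha> \<beta>) = 4" "dim_col (H_tilde w \<alpha> \<beta>) = 9"
  "dim_row (H_block w) = 2" "dim_col (H_block w) = 5"
  by (simp_all add: H_tilde_def H_block_def mat_of_rows_list_def)

text \<open>Writing \<open>l\<close> as \<open>m + 2\<close> avoids the truncated subtraction
  \<open>l - 2\<close>; here \<open>m\<close> counts the blocks after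
  \<open>H_tilde\<close>.\<close>

lemma H_mat_carrier: "H_mat w \<alpha> \<beta> (m + 2) \<in> carrier_mat (4 + 2 * m) (9 + 5 * m)"
  unfolding H_mat_def
  by (rule four_block_carrier_mat) (auto simp: kronecker_def)

lemma sum_upto_9: "(\<Sum>j=0..<9::nat. f j) = f 0 + f 1 + f 2 + f 3 + f 4 + f 5 + f 6 + f 7 + f 8"
  by (simp add: eval_nat_numeral)

lemma sum_upto_5: "(\<Sum>j=0..<5::nat. f j) = f 0 + f 1 + f 2 + f 3 + f 4"
  by (simp add: eval_nat_numeral)

text \<open>Each row of \<open>H_mat\<close> vanishes outside a single diagonal block, so only the
  coordinates of that block remain in the sum.\<close>

lemma H_mat_mult:
  fixes x :: "'a::field vec"
  assumes x: "x \<in> carrier_vec (9 + 5 * m)" and i: "i < 4 + 2 * m"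
  shows "(H_mat w \<alpha> \<beta> (m + 2) *\<^sub>v x) $ i =
    (if i < 4 then \<Sum>j=0..<9. H_tilde w \<alpha> \<beta> $$ (i, j) * x $ j
     else \<Sum>j=0..<5. H_block w $$ (i mod 2, j) * x $ (9 + 5 * ((i - 4) div 2) + j))"
proof -
  let ?H = "H_mat w \<alpha> \<beta> (m + 2)"
  have dims: "dim_row ?H = 4 + 2 * m" "dim_col ?H = 9 + 5 * m"
    using H_mat_carrier[of w \<alpha> \<beta> m] by auto
  \<comment> \<open>In the Kronecker part, the identity factor is 1 exactly when row and column have
    the same block index.\<close>
  have ent: "?H $$ (i, j) = (if i < 4 then if j < 9 then H_tilde w \<alpha> \<beta> $$ (i, j) else 0
      else if j < 9 then 0
      else if (j - 9) div 5 = (i - 4) div 2 then H_block w $$ ((i - 4) mod 2, (j - 9) mod 5) else 0)"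
    if "j < 9 + 5 * m" for j
    using that i unfolding H_mat_def
    by (auto simp: kronecker_def less_mult_imp_div_less)
  have eq: "(?H *\<^sub>v x) $ i = (\<Sum>j=0..<9 + 5 * m. ?H $$ (i, j) * x $ j)"
    using x i dims by (auto simp: scalar_prod_def intro!: sum.cong)
  show ?thesis
  proof (cases "i < 4")
    case True
    have "(\<Sum>j=0..<9 + 5 * m. ?H $$ (i, j) * x $ j)
      = (\<Sum>j=0..<9. H_tilde w \<alpha> \<beta> $$ (i, j) * x $ j)"
      using True by (intro sum.mono_neutral_cong_right) (auto simp: ent)
    with True eq show ?thesis by simp
  next
    case False
    let ?b = "(i - 4) div 2"
    have b: "?b < m" using i False by auto
    have par: "(i - 4) mod 2 = i mod 2" using False by presburger
    \<comment> \<open>The bounds are written as \<open>0 + _\<close> and \<open>5 + _\<close> so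
      that the index shift back to \<open>0..<5\<close> applies.\<close>
    have "(\<Sum>j=0..<9 + 5 * m. ?H $$ (i, j) * x $ j)
      = (\<Sum>j=0 + (9 + 5 * ?b)..<5 + (9 + 5 * ?b). H_block w $$ (i mod 2, (j - 9) mod 5) * x $ j)"
    proof (rule sum.mono_neutral_cong_right)
      show "{0 + (9 + 5 * ?b)..<5 + (9 + 5 * ?b)} \<subseteq> {0..<9 + 5 * m}" using b by auto
      show "\<forall>j\<in>{0..<9 + 5 * m} - {0 + (9 + 5 * ?b)..<5 + (9 + 5 * ?b)}. ?H $$ (i, j) * x $ j = 0"
      proof
        fix j assume j: "j \<in> {0..<9 + 5 * m} - {0 + (9 + 5 * ?b)..<5 + (9 + 5 * ?b)}"
        then have "j < 9 \<or> (j - 9) div 5 \<noteq> ?b" by (auto simp: not_le)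
        with j False show "?H $$ (i, j) * x $ j = 0" by (auto simp: ent)
      qed
      fix j assume j: "j \<in> {0 + (9 + 5 * ?b)..<5 + (9 + 5 * ?b)}"
      then have "(j - 9) div 5 = ?b" by (auto simp: div_nat_eqI)
      with j b False par
      show "?H $$ (i, j) * x $ j = H_block w $$ (i mod 2, (j - 9) mod 5) * x $ j"
        by (subst ent) auto
    qed simp
    also have "\<dots> = (\<Sum>j=0..<5. H_block w $$ (i mod 2, j) * x $ (9 + 5 * ?b + j))"
      by (subst sum.shift_bounds_nat_ivl) (auto simp: add_ac intro!: sum.cong)
    finally show ?thesis using False eq by simp
  qed
qed

lemma H_mat_mult_rows:
  fixes x :: "'a::field vec" and w \<alpha> \<beta> :: 'a
  assumes x: "x \<in> carrier_vec (9 + 5 * m)"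
  defines "y \<equiv> H_mat w \<alpha> \<beta> (m + 2) *\<^sub>v x"
  shows "y $ 0 = x $ 0 + x $ 2 + x $ 3 + \<alpha> * x $ 4"
    and "y $ 1 = x $ 1 + x $ 2 + w * x $ 3 + \<beta> * x $ 4"
    and "y $ 2 = x $ 4 + x $ 6 + x $ 7 + x $ 8"
    and "y $ 3 = x $ 5 + x $ 6 + w * x $ 7 + w^2 * x $ 8"
    and "b < m \<Longrightarrow> y $ (4 + 2 * b)
      = x $ (9 + 5 * b) + x $ (9 + 5 * b + 2) + x $ (9 + 5 * b + 3) + x $ (9 + 5 * b + 4)"
    and "b < m \<Longrightarrow> y $ (5 + 2 * b)
      = x $ (9 + 5 * b + 1) + x $ (9 + 5 * b + 2) + w * x $ (9 + 5 * b + 3) + w^2 * x $ (9 + 5 * b + 4)"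
  unfolding y_def
  by (simp_all add: H_mat_mult[OF x] sum_upto_9 sum_upto_5 H_tilde_def H_block_def mat_of_rows_list_def)

lemma less_4_plus_double_cases:
  assumes "i < 4 + 2 * (m::nat)"
  obtains "i = 0" | "i = 1" | "i = 2" | "i = 3"
    | b where "b < m" "i = 4 + 2 * b" | b where "b < m" "i = 5 + 2 * b"
proof (cases "i < 4")
  case True
  then show ?thesis using that(1-4) by (auto simp: less_Suc_eq eval_nat_numeral)
next
  case False
  define b where "b = (i - 4) div 2"
  have "b < m" "i = 4 + 2 * b \<or> i = 5 + 2 * b" using False assms unfolding b_def by presburger+
  then show ?thesis using that(5,6) by blast
qed

text \<open>Explicit codewords and local weights are checked through these scalar equations rather
  than through the matrix.\<close>

lemma mem_parity_check_code_H_mat_iff: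
  fixes x :: "'a::field vec"
  shows "x \<in> parity_check_code (H_mat w \<alpha> \<beta> (m + 2)) \<longleftrightarrow>
    x \<in> carrier_vec (9 + 5 * m) \<and>
    x $ 0 + x $ 2 + x $ 3 + \<alpha> * x $ 4 = 0 \<and>
    x $ 1 + x $ 2 + w * x $ 3 + \<beta> * x $ 4 = 0 \<and>
    x $ 4 + x $ 6 + x $ 7 + x $ 8 = 0 \<and>
    x $ 5 + x $ 6 + w * x $ 7 + w^2 * x $ 8 = 0 \<and>
    (\<forall>b<m. x $ (9 + 5 * b) + x $ (9 + 5 * b + 2) + x $ (9 + 5 * b + 3) + x $ (9 + 5 * b + 4) = 0 \<and>
      x $ (9 + 5 * b + 1) + x $ (9 + 5 * b + 2) + w * x $ (9 + 5 * b + 3) + w^2 * x $ (9 + 5 * b + 4) = 0)"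
    (is "_ \<longleftrightarrow> _ \<and> ?E")
proof (cases "x \<in> carrier_vec (9 + 5 * m)")
  case True
  note H = H_mat_carrier[of w \<alpha> \<beta> m]
  let ?y = "H_mat w \<alpha> \<beta> (m + 2) *\<^sub>v x"
  note rows = H_mat_mult_rows[OF True, where w = w and \<alpha> = \<alpha> and \<beta> = \<beta>]
  have "?y = 0\<^sub>v (4 + 2 * m) \<longleftrightarrow> (\<forall>i<4 + 2 * m. ?y $ i = 0)"
    using H by (auto simp: vec_eq_iff)
  also have "\<dots> \<longleftrightarrow> ?y $ 0 = 0 \<and> ?y $ 1 = 0 \<and> ?y $ 2 = 0 \<and> ?y $ 3 = 0 \<and>
      (\<forall>b<m. ?y $ (4 + 2 * b) = 0 \<and> ?y $ (5 + 2 * b) = 0)" (is "?A \<longleftrightarrow> ?B")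
  proof
    show "?B" if "?A" using that by auto
    show "?A" if "?B"
    proof (intro allI impI)
      fix i assume "i < 4 + 2 * m"
      then show "?y $ i = 0" by (rule less_4_plus_double_cases) (use that in auto)
    qed
  qed
  also have "\<dots> \<longleftrightarrow> ?E"
    unfolding rows(1-4) using rows(5,6) by metis
  finally show ?thesis
    using True H by (simp add: parity_check_code_def mat_kernel)
next
  case False
  then show ?thesis
    using mat_kernel_carrier[OF H_mat_carrier, of w \<alpha> \<beta> m] by (auto simp: parity_check_code_def)
qed

text \<open>Columns 0, 1, 5 and the first two of each later block are distinct unit vectors; column
  4 is the missing one up to its entries \<alpha> and \<beta>. The entries of \<open>y\<close> are
  placed at these coordinates, and the subtractions at 0 and 1 cancel the contribution of column
  4.\<close>

lemma H_mat_surj: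
  fixes y :: "'a::field vec"
  assumes y: "y \<in> carrier_vec (4 + 2 * m)"
  shows "\<exists>x\<in>carrier_vec (9 + 5 * m). H_mat w \<alpha> \<beta> (m + 2) *\<^sub>v x = y"
proof -
  define x where "x = vec (9 + 5 * m) (\<lambda>j.
    if j = 0 then y $ 0 - \<alpha> * y $ 2 else if j = 1 then y $ 1 - \<beta> * y $ 2
    else if j = 4 then y $ 2 else if j = 5 then y $ 3 else if j < 9 then 0
    else if (j - 9) mod 5 < 2 then y $ (4 + 2 * ((j - 9) div 5) + (j - 9) mod 5) else 0)"
  have x: "x \<in> carrier_vec (9 + 5 * m)" by (simp add: x_def)
  note rows = H_mat_mult_rows[OF x, where w = w and \<alpha> = \<alpha> and \<beta> = \<beta>]
  have blk: "x $ (9 + 5 * b + s) = (if s < 2 then y $ (4 + 2 * b + s) else 0)"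
    if "b < m" "s < 5" for b s
    using that by (simp add: x_def)
  have "H_mat w \<alpha> \<beta> (m + 2) *\<^sub>v x = y"
  proof (rule eq_vecI)
    fix i assume "i < dim_vec y"
    then have "i < 4 + 2 * m" using y by simp
    then show "(H_mat w \<alpha> \<beta> (m + 2) *\<^sub>v x) $ i = y $ i"
    proof (rule less_4_plus_double_cases)
      fix b assume b: "b < m" "i = 4 + 2 * b"
      then show ?thesis using blk[of b 0] blk[of b 2] blk[of b 3] blk[of b 4]
        by (simp only: rows) simp
    next
      fix b assume b: "b < m" "i = 5 + 2 * b"
      then show ?thesis using blk[of b 1] blk[of b 2] blk[of b 3] blk[of b 4]
        by (simp only: rows) simp
    qed (simp_all only: rows, simp_all add: x_def)
  qed (use y H_mat_carrier[of w \<alpha> \<beta> m] in auto)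
  with x show ?thesis by blast
qed

section \<open>Repair groups and their local weights\<close>

lemma mds_block_count:
  fixes w :: "'a::field"
  assumes w: "w^2 = w + 1"
    and e: "x0 + x2 + x3 + x4 = 0" "x1 + x2 + w * x3 + w^2 * x4 = 0"
  defines "N \<equiv> (if x0 \<noteq> 0 then 1 else 0) + (if x1 \<noteq> 0 then 1 else 0) + (if x2 \<noteq> 0 then 1 else 0)
    + (if x3 \<noteq> 0 then 1 else 0) + (if x4 \<noteq> 0 then 1 else (0::nat))"
  shows "N = 0 \<or> 3 \<le> N"
proof -
  \<comment> \<open>The elements 1, \<open>w\<close> and \<open>w^2\<close> are distinct and
    nonzero, so the five columns of \<open>H_block w\<close> are pairwise independent.\<close>
  have w0: "w \<noteq> 0" using w by auto
  have w1: "w \<noteq> 1" using w by (metis add_cancel_right_right power_one zero_neq_one)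
  have w2: "w \<noteq> w^2" using w by auto
  have w3: "w^2 \<noteq> 1" using w w0 by auto
  have p: "c = 0 \<and> d = 0" if "c + d = 0" "s * c + t * d = 0" "s \<noteq> t" for c d s t :: 'a
  proof -
    have "d = - c" using that(1) by (simp add: add_eq_0_iff)
    with that(2) have "(s - t) * c = 0" by (simp add: algebra_simps)
    with that(3) \<open>d = - c\<close> show ?thesis by simp
  qed
  \<comment> \<open>Three vanishing entries force the other two to vanish. Of the ten remaining
    pairs, \<open>a\<close> treats the seven containing coordinate 0 or 1, whose column is a unit
    vector; \<open>b\<close>, \<open>c\<close> and \<open>d\<close> treat the pairs among the last
    three columns by \<open>p\<close>.\<close>
  have a: "x2 = 0 \<Longrightarrow> x3 = 0 \<Longrightarrow> x4 = 0 \<Longrightarrow> x0 = 0 \<and> x1 = 0"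
      "x1 = 0 \<Longrightarrow> x3 = 0 \<Longrightarrow> x4 = 0 \<Longrightarrow> x0 = 0 \<and> x2 = 0"
      "x1 = 0 \<Longrightarrow> x2 = 0 \<Longrightarrow> x4 = 0 \<Longrightarrow> x0 = 0 \<and> x3 = 0"
      "x1 = 0 \<Longrightarrow> x2 = 0 \<Longrightarrow> x3 = 0 \<Longrightarrow> x0 = 0 \<and> x4 = 0"
      "x0 = 0 \<Longrightarrow> x3 = 0 \<Longrightarrow> x4 = 0 \<Longrightarrow> x1 = 0 \<and> x2 = 0"
      "x0 = 0 \<Longrightarrow> x2 = 0 \<Longrightarrow> x4 = 0 \<Longrightarrow> x1 = 0 \<and> x3 = 0"
      "x0 = 0 \<Longrightarrow> x2 = 0 \<Longrightarrow> x3 = 0 \<Longrightarrow> x1 = 0 \<and> x4 = 0"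
    using e w0 by auto
  have b: "x0 = 0 \<Longrightarrow> x1 = 0 \<Longrightarrow> x4 = 0 \<Longrightarrow> x2 = 0 \<and> x3 = 0"
    using e w1 p[of x2 x3 1 w] by auto
  have c: "x0 = 0 \<Longrightarrow> x1 = 0 \<Longrightarrow> x3 = 0 \<Longrightarrow> x2 = 0 \<and> x4 = 0"
    using e w3 p[of x2 x4 1 "w^2"] by auto
  have d: "x0 = 0 \<Longrightarrow> x1 = 0 \<Longrightarrow> x2 = 0 \<Longrightarrow> x3 = 0 \<and> x4 = 0"
    using e w2 p[of x3 x4 w "w^2"] by auto
  show ?thesis
    unfolding N_def
    by (cases "x0 = 0"; cases "x1 = 0"; cases "x2 = 0"; cases "x3 = 0"; cases "x4 = 0"; simp)
      (use a b c d in blast)+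
qed

text \<open>Here \<open>x\<close> is a function rather than a vector, so that an entry can be
  overwritten before the bound is applied.\<close>

lemma mds_block_weight:
  fixes x :: "nat \<Rightarrow> 'a::field"
  assumes w: "w^2 = w + 1"
    and e1: "x a + x (a + 2) + x (a + 3) + x (a + 4) = 0"
    and e2: "x (a + 1) + x (a + 2) + w * x (a + 3) + w^2 * x (a + 4) = 0"
  shows "card {i \<in> {a..<a + 5}. x i \<noteq> 0} = 0 \<or> 3 \<le> card {i \<in> {a..<a + 5}. x i \<noteq> 0}"
proof -
  have "card {i \<in> {a..<a + 5}. x i \<noteq> 0} = (\<Sum>i = a..<a + 5. if x i \<noteq> 0 then 1 else 0)"
    by (simp add: sum.If_cases Int_def)
  also have "\<dots> = (\<Sum>i = 0..<5. if x (a + i) \<noteq> 0 then 1 else 0)"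
    using sum.shift_bounds_nat_ivl[of "\<lambda>i. if x i \<noteq> 0 then 1 else (0::nat)" 0 a 5]
    by (simp add: add.commute)
  finally have card: "card {i \<in> {a..<a + 5}. x i \<noteq> 0}
      = (\<Sum>i = 0..<5. if x (a + i) \<noteq> 0 then 1 else 0)" .
  \<comment> \<open>The summand \<open>a + 0\<close> is the form in which \<open>sum_upto_5\<close>
    produces the first index.\<close>
  have *: "x (a + 0) + x (a + 2) + x (a + 3) + x (a + 4) = 0" using e1 by simp
  show ?thesis
    unfolding card sum_upto_5 using mds_block_count[OF w * e2] .
qed

text \<open>Serves both the locality and the lower bound on the distance; the size 5 is
  \<open>r + \<delta> - 1\<close> for \<open>r = \<delta> = 3\<close>.\<close>

lemma repair_group:
  fixes w \<alpha> \<beta> :: "'a::field"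
  assumes w: "w^2 = w + 1"
    and ab: "(\<alpha>, \<beta>) = (0, 0) \<or> (\<alpha>, \<beta>) = (1, w^2)"
    and i: "i < 9 + 5 * m"
  obtains R where "R \<subseteq> {..<9 + 5 * m}" "i \<in> R" "card R \<le> 5"
    "\<And>c. c \<in> parity_check_code (H_mat w \<alpha> \<beta> (m + 2)) \<Longrightarrow>
      card {i \<in> R. c $ i \<noteq> 0} = 0 \<or> 3 \<le> card {i \<in> R. c $ i \<noteq> 0}"
proof -
  let ?C = "parity_check_code (H_mat w \<alpha> \<beta> (m + 2))"
  note mem = mem_parity_check_code_H_mat_iff[of _ w \<alpha> \<beta> m]
  note wt = mds_block_weight[OF w]
  consider (zero) "i < 4" "(\<alpha>, \<beta>) = (0, 0)" | (one) "i < 4" "(\<alpha>, \<beta>) = (1, w^2)"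
    | (mid) "4 \<le> i" "i < 9" | (block) "9 \<le> i"
    using ab by linarith
  then show ?thesis
  proof cases
    case zero
    show ?thesis
    proof (rule that[of "{0..<4}"])
      fix c assume c: "c \<in> ?C"
      \<comment> \<open>Coordinate 4 does not enter the first two checks here, so overwriting it by
        0 gives a word of a full block with the same support on \<open>{0..<4}\<close>.\<close>
      let ?x = "\<lambda>j. if j = 4 then 0 else c $ j"
      have "{i \<in> {0..<0 + 5}. ?x i \<noteq> 0} = {i \<in> {0..<4}. c $ i \<noteq> 0}" by auto
      then show "card {i \<in> {0..<4}. c $ i \<noteq> 0} = 0 \<or> 3 \<le> card {i \<in> {0..<4}. c $ i \<noteq> 0}"
        using wt[of ?x 0] c zero by (auto simp: mem)
    qed (use zero in auto)
  next
    case one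
    \<comment> \<open>The pair \<open>(1, w^2)\<close> is the last column of
      \<open>H_block w\<close>, so the first two checks form a full block on
      \<open>{0..<5}\<close>.\<close>
    show ?thesis
    proof (rule that[of "{0..<5}"])
      fix c assume c: "c \<in> ?C"
      then show "card {i \<in> {0..<5}. c $ i \<noteq> 0} = 0 \<or> 3 \<le> card {i \<in> {0..<5}. c $ i \<noteq> 0}"
        using wt[of "\<lambda>j. c $ j" 0] one by (auto simp: mem)
    qed (use one in auto)
  next
    case mid
    show ?thesis
    proof (rule that[of "{4..<9}"])
      fix c assume c: "c \<in> ?C"
      then show "card {i \<in> {4..<9}. c $ i \<noteq> 0} = 0 \<or> 3 \<le> card {i \<in> {4..<9}. c $ i \<noteq> 0}"
        using wt[of "\<lambda>j. c $ j" 4] by (auto simp: mem)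
    qed (use mid in auto)
  next
    case block
    define b where "b = (i - 9) div 5"
    have b: "b < m" "9 + 5 * b \<le> i" "i < 9 + 5 * b + 5"
      using block i unfolding b_def by linarith+
    show ?thesis
    proof (rule that[of "{9 + 5 * b..<9 + 5 * b + 5}"])
      fix c assume c: "c \<in> ?C"
      then show "card {i \<in> {9 + 5 * b..<9 + 5 * b + 5}. c $ i \<noteq> 0} = 0
          \<or> 3 \<le> card {i \<in> {9 + 5 * b..<9 + 5 * b + 5}. c $ i \<noteq> 0}"
        using b(1) by (intro wt) (simp_all only: mem)
    qed (use b in auto)
  qed
qed

lemma code_subset_carrier:
  "parity_check_code (H_mat w \<alpha> \<beta> (m + 2)) \<subseteq> carrier_vec (9 + 5 * m)"
  unfolding parity_check_code_def by (rule mat_kernel_carrier[OF H_mat_carrier])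

lemma lrc_code_H_mat:
  fixes w \<alpha> \<beta> :: "'a::field"
  assumes "w^2 = w + 1" "(\<alpha>, \<beta>) = (0, 0) \<or> (\<alpha>, \<beta>) = (1, w^2)"
  shows "lrc_code (9 + 5 * m) 3 3 (parity_check_code (H_mat w \<alpha> \<beta> (m + 2)))"
  unfolding lrc_code_def
proof (intro conjI allI impI)
  show "linear_code (9 + 5 * m) (parity_check_code (H_mat w \<alpha> \<beta> (m + 2)))"
    by (rule linear_parity_check_code[OF H_mat_carrier])
  fix i assume "i < 9 + 5 * m"
  with assms obtain R where "R \<subseteq> {..<9 + 5 * m}" "i \<in> R" "card R \<le> 5"
    "\<And>c. c \<in> parity_check_code (H_mat w \<alpha> \<beta> (m + 2)) \<Longrightarrow>
      card {i \<in> R. c $ i \<noteq> 0} = 0 \<or> 3 \<le> card {i \<in> R. c $ i \<noteq> 0}"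
    by (rule repair_group) blast
  moreover from this have
    "min_dist_at_least 3 (puncture R (parity_check_code (H_mat w \<alpha> \<beta> (m + 2))))"
    using min_dist_at_least_puncture[OF code_subset_carrier] by blast
  ultimately show "\<exists>R\<subseteq>{..<9 + 5 * m}. i \<in> R \<and> card R \<le> 3 + 3 - 1 \<and>
      min_dist_at_least 3 (puncture R (parity_check_code (H_mat w \<alpha> \<beta> (m + 2))))"
    by auto
qed

section \<open>Minimum distance\<close>

lemma min_dist_H_mat:
  fixes w \<alpha> \<beta> :: "'a::field"
  assumes char2: "(1::'a) + 1 = 0"
    and w: "w^2 = w + 1"
    and ab: "(\<alpha>, \<beta>) = (0, 0) \<or> (\<alpha>, \<beta>) = (1, w^2)"
  shows "min_dist (parity_check_code (H_mat w \<alpha> \<beta> (m + 2))) = 3"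
  unfolding min_dist_def
proof (rule cInf_eq_minimum)
  let ?C = "parity_check_code (H_mat w \<alpha> \<beta> (m + 2))"
  let ?n = "9 + 5 * m"
  \<comment> \<open>Columns 0, 1 and 2 sum to zero in characteristic two, which gives a word of
    weight 3.\<close>
  let ?u = "vec ?n (\<lambda>j. if j < 3 then 1 else 0) :: 'a vec"
  have "?u \<in> ?C" "0\<^sub>v ?n \<in> ?C"
    using char2 by (simp_all add: mem_parity_check_code_H_mat_iff)
  moreover have "{i. i < dim_vec ?u \<and> ?u $ i \<noteq> 0\<^sub>v ?n $ i} = {..<3}"
    by (auto split: if_splits)
  then have "hamming_dist ?u (0\<^sub>v ?n) = 3" by (simp add: hamming_dist_def)
  moreover from this have "?u \<noteq> 0\<^sub>v ?n" by (auto simp: hamming_dist_def)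
  ultimately show "3 \<in> {hamming_dist x y |x y. x \<in> ?C \<and> y \<in> ?C \<and> x \<noteq> y}"
    by (intro CollectI exI[of _ ?u] exI[of _ "0\<^sub>v ?n"]) simp
  fix d assume "d \<in> {hamming_dist x y |x y. x \<in> ?C \<and> y \<in> ?C \<and> x \<noteq> y}"
  then obtain x y where d: "d = hamming_dist x y" and xy: "x \<in> ?C" "y \<in> ?C" "x \<noteq> y" by blast
  have carrier: "x \<in> carrier_vec ?n" "y \<in> carrier_vec ?n" using xy code_subset_carrier by blast+
  \<comment> \<open>The difference of two codewords is a codeword, so the local weight bound applies
    to it on the group of a coordinate where they differ.\<close>
  have "x - y \<in> ?C"
    using carrier xy(1,2)[unfolded parity_check_code_def, THEN mat_kernelD(2)[OF H_mat_carrier]]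
    by (auto simp: parity_check_code_def mult_minus_distrib_mat_vec[OF H_mat_carrier]
        intro!: mat_kernelI[OF H_mat_carrier])
  from xy(3) carrier obtain i where i: "i < ?n" "x $ i \<noteq> y $ i" by (auto simp: vec_eq_iff)
  from w ab i(1) obtain R where R: "R \<subseteq> {..<?n}" "i \<in> R"
    and wt: "\<And>c. c \<in> ?C \<Longrightarrow> card {i \<in> R. c $ i \<noteq> 0} = 0 \<or> 3 \<le> card {i \<in> R. c $ i \<noteq> 0}"
    by (rule repair_group) blast
  have fin: "finite R" using R(1) finite_subset by blast
  have "card {i \<in> R. (x - y) $ i \<noteq> 0} \<noteq> 0"
    using R i carrier fin by auto
  with wt[OF \<open>x - y \<in> ?C\<close>] have "3 \<le> card {i \<in> R. (x - y) $ i \<noteq> 0}" by linarith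
  also have "\<dots> \<le> d"
    unfolding d hamming_dist_def using R(1) carrier by (intro card_mono) auto
  finally show "3 \<le> d" .
qed

section \<open>Optimality of the locality parameter\<close>

lemma r_optimal_H_mat:
  fixes w \<alpha> \<beta> :: "'a::field"
  assumes char2: "(1::'a) + 1 = 0"
    and w: "w^2 = w + 1"
  shows "r_optimal (9 + 5 * m) 3 3 (parity_check_code (H_mat w \<alpha> \<beta> (m + 2)))"
  unfolding r_optimal_def
proof (intro allI impI notI)
  let ?C = "parity_check_code (H_mat w \<alpha> \<beta> (m + 2))"
  let ?n = "9 + 5 * m"
  fix r assume r: "1 \<le> r \<and> r < 3" and lrc: "lrc_code ?n r 3 ?C"
  \<comment> \<open>It suffices to refute locality at one coordinate: for \<open>r \<le> 2\<close>,
    coordinate 5 has no repair set, as such a set would have at most 4 elements.\<close>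
  have "5 < ?n" by simp
  with lrc obtain R where R: "R \<subseteq> {..<?n}" "5 \<in> R" "card R \<le> r + 3 - 1"
    and "min_dist_at_least 3 (puncture R ?C)"
    unfolding lrc_code_def by blast
  then have wt: "card {i \<in> R. c $ i \<noteq> 0} = 0 \<or> 3 \<le> card {i \<in> R. c $ i \<noteq> 0}" if "c \<in> ?C" for c
    using that min_dist_at_least_puncture[OF code_subset_carrier] by blast
  have fin: "finite R" using R(1) finite_subset by blast
  have dbl: "a + a = 0" for a :: 'a
    using char2 by (metis mult_zero_right mult.right_neutral ring_class.ring_distribs(1))
  \<comment> \<open>For \<open>?u\<close> and \<open>?v\<close>, two ones at 6, 7 or 6, 8 satisfy
    the third check, and the fourth determines the entry at 5: \<open>1 + w = w^2\<close> or
    \<open>1 + w^2 = w\<close>. In \<open>?z\<close> the ones at 4, 5, 6 satisfy both of these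
    checks, and \<alpha>, \<beta> at 0, 1 cancel column 4 in the first two.\<close>
  let ?u = "vec ?n (\<lambda>j. if j = 5 then w^2 else if j = 6 \<or> j = 7 then 1 else 0)"
  let ?v = "vec ?n (\<lambda>j. if j = 5 then w else if j = 6 \<or> j = 8 then 1 else 0)"
  let ?z = "vec ?n (\<lambda>j. if j = 0 then \<alpha> else if j = 1 then \<beta> else if j \<in> {4, 5, 6} then 1 else 0)"
  have w_sum: "w^2 + 1 + w = 0" "w + 1 + w^2 = 0"
    using dbl[of "w + 1"] by (simp_all add: w add_ac)
  have words: "?u \<in> ?C" "?v \<in> ?C" "?z \<in> ?C"
    using w_sum by (simp_all add: mem_parity_check_code_H_mat_iff dbl char2)
  have w0: "w \<noteq> 0" using w by auto
  \<comment> \<open>The word is nonzero at 5, which lies in \<open>R\<close>, so at least three of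
    its nonzero positions lie in \<open>R\<close>; there are only three.\<close>
  have full: "S \<subseteq> R" if "c \<in> ?C" "{i. i < ?n \<and> c $ i \<noteq> 0} = S" "5 \<in> S" "card S = 3" for c S
  proof -
    have eq: "{i \<in> R. c $ i \<noteq> 0} = R \<inter> S" using that(2) R(1) by auto
    have "finite S" using that(4) card_ge_0_finite by force
    moreover have "3 \<le> card (R \<inter> S)"
      using wt[OF that(1)] R(2) that(3) fin unfolding eq by auto
    ultimately show ?thesis using that(4)
      by (metis Int_lower1 Int_lower2 card_mono card_subset_eq le_antisym)
  qed
  have "{5, 6, 7} \<subseteq> R" by (rule full[OF words(1)]) (use w0 in \<open>auto split: if_splits\<close>)
  moreover have "{5, 6, 8} \<subseteq> R" by (rule full[OF words(2)]) (use w0 in \<open>auto split: if_splits\<close>)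
  ultimately have "{5, 6, 7, 8} \<subseteq> R" by simp
  moreover have "card R \<le> card {5, 6, 7, 8::nat}" using R(3) r by simp
  ultimately have "R = {5, 6, 7, 8}" using fin card_seteq by metis
  \<comment> \<open>Of the support of \<open>?z\<close>, the positions 0, 1 and 4 fall outside
    \<open>R\<close>, so exactly two remain.\<close>
  then have "{i \<in> R. ?z $ i \<noteq> 0} = {5, 6}" by auto
  with wt[OF words(3)] show False by simp
qed

theorem mainTheorem7:
  fixes w \<alpha> \<beta> :: "'a::{field,finite}" and l :: nat
  assumes "CARD('a) = 4"
    and "w^2 = w + 1"
    and "l \<ge> 2"
    and "(\<alpha>, \<beta>) = (0, 0) \<or> (\<alpha>, \<beta>) = (1, w^2)"
  shows "optimal_lrc_code (5 * l - 1) (3 * l - 1) 3 3 3 (parity_check_code (H_mat w \<alpha> \<beta> l))"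
proof -
  obtain m where l: "l = m + 2" using assms(3) by (metis add.commute le_Suc_ex)
  let ?C = "parity_check_code (H_mat w \<alpha> \<beta> (m + 2))"
  have char2: "(1::'a) + 1 = 0" using assms(1) by (rule two_eq_0)
  have n: "5 * l - 1 = 9 + 5 * m" and k: "3 * l - 1 = 5 + 3 * m" using l by simp_all
  have "code_dim (9 + 5 * m) ?C = 9 + 5 * m - (4 + 2 * m)"
    by (rule code_dim_parity_check_code[OF H_mat_carrier H_mat_surj])
  then have "nkd_code (9 + 5 * m) (5 + 3 * m) 3 ?C"
    using linear_parity_check_code[OF H_mat_carrier] min_dist_H_mat[OF char2 assms(2,4)]
    by (simp add: nkd_code_def)
  moreover have "d_optimal (9 + 5 * m) (5 + 3 * m) 3 3 3"
  proof -
    \<comment> \<open>The Singleton-type bound then evaluates to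
      \<open>(9 + 5 * m) - (5 + 3 * m) + 1 - 2 * (m + 1) = 3\<close>.\<close>
    have "\<lceil>real (5 + 3 * m) / real 3\<rceil> = int m + 2"
      by (rule ceiling_unique) (simp_all add: field_simps)
    then show ?thesis unfolding d_optimal_def by simp
  qed
  ultimately show ?thesis
    unfolding n k unfolding l optimal_lrc_code_def
    using lrc_code_H_mat[OF assms(2,4)] r_optimal_H_mat[OF char2 assms(2)] by simp
qed

end
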